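(* Suppose $q\le \alpha/K$. Then a saddle point for the stochastic game with expected pay-off $M_x$ is given by $\sigma^*=0$, $\tau^*=\tau^+_{\log K}:=\inf\{t>0: X_t>\log K\}$; that is, for every $x\in\mathbb{R}$, $M_x(\tau,\sigma^* )\le M_x(\tau^*,\sigma^* )\le M_x(\tau^*,\sigma)$ for all $\tau,\sigma\in\mathcal{T}_{0,\infty}$. In particular the value of the game is $V(x)=K\vee e^x$ for all $x$.
   Context: Process. $X=(X_t,t\ge0)$ is a spectrally positive Lévy process (no negative jumps, and not a subordinator) on a filtered probability space $(\Omega,\mathcal F,\mathbb F,\mathbb P)$, where $\mathbb F$ is the naturally enlarged filtration generated by $X$; $\mathbb P_x$ is the law of $X$ started at $x\in\mathbb R$, $\mathbb E_x$ its expectation, $\mathbb{P}=\mathbb{P}_0$, $\mathbb E=\mathbb E_0$. Its Laplace exponent $\psi$ is defined by $\mathbb E[e^{-\theta X_t}]=e^{t\psi(\theta)}$, with $\psi(\theta)=\mu\theta+\frac{b^2}{2}\theta^2+\int_{(0,\infty)}(e^{-\theta x}-1+\theta x\mathbf 1_{\{x<1\}})\Pi(dx)$, where $\mu\in\mathbb R$, $b^2\ge0$, and the Lévy measure $\Pi$ satisfies $\int_{(0,\infty)}(1\wedge x^2)\Pi(dx)<\infty$. It is assumed throughout that $\Pi$ has no atoms when $X$ has paths of bounded variation. Game. $\alpha\ge0$ and $\beta,q,K>0$ are constants, and it is assumed throughout that $\psi(-1)<q$ (in particular $\psi(-1)$ is finite). Let $L_t=e^{-qt+X_t}+\int_0^te^{-qs}(\alpha+\beta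 e^{X_s})\,ds$ and $U_t=e^{-qt}(e^{X_t}\vee K)+\int_0^te^{-qs}(\alpha+\beta e^{X_s})\,ds$, with $U_\infty=\int_0^\infty e^{-qs}(\alpha+\beta e^{X_s})\,ds$. $\mathcal T_{0,\infty}$ is the set of $[0,\infty]$-valued $\mathbb F$-stopping times, and for $\tau,\sigma\in\mathcal T_{0,\infty}$, $M_x(\tau,\sigma)=\mathbb E_x[L_\tau\mathbf 1_{\{\tau<\sigma\}}+U_\sigma\mathbf 1_{\{\sigma\le\tau\}}]$. The value of the game, when it exists, is $V(x)=\sup_\tau\inf_\sigma M_x(\tau,\sigma)=\inf_\sigma\sup_\tau M_x(\tau,\sigma)$. *)

theory Defs
  imports "HOL-Probability.Probability"
begin

section \<open>Spectrally positive Levy processes\<close>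

text \<open>Only the values \<open>X t\<close> with \<open>t \<ge> 0\<close> are meaningful.\<close>

definition cadlag :: "(real \<Rightarrow> real) \<Rightarrow> bool" where
  "cadlag f \<longleftrightarrow>
     (\<forall>t\<ge>0. (f \<longlongrightarrow> f t) (at_right t)) \<and>
     (\<forall>t>0. \<exists>l. (f \<longlongrightarrow> l) (at_left t))"

locale levy_process = prob_space M for M :: "'w measure" +
  fixes X :: "real \<Rightarrow> 'w \<Rightarrow> real"
  assumes random_variable_X: "\<And>t. 0 \<le> t \<Longrightarrow> random_variable borel (X t)"
    and start_zero: "AE \<omega> in M. X 0 \<omega> = 0"
    and cadlag_paths: "AE \<omega> in M. cadlag (\<lambda>t. X t \<omega>)"
    and independent_increments:
      "\<And>(n::nat) (t :: nat \<Rightarrow> real). 0 \<le> t 0 \<Longrightarrow> mono_on {..n} t \<Longrightarrow>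
         indep_vars (\<lambda>_. borel) (\<lambda>i \<omega>. X (t (Suc i)) \<omega> - X (t i) \<omega>) {..<n}"
    and stationary_increments:
      "\<And>s t. 0 \<le> s \<Longrightarrow> s \<le> t \<Longrightarrow>
         distr M borel (\<lambda>\<omega>. X t \<omega> - X s \<omega>) = distr M borel (X (t - s))"

locale spectrally_positive_levy_process = levy_process +
  assumes no_negative_jumps:
      "AE \<omega> in M. \<forall>t>0. \<forall>l. ((\<lambda>s. X s \<omega>) \<longlongrightarrow> l) (at_left t) \<longrightarrow> l \<le> X t \<omega>"
    and not_subordinator: "\<not> (AE \<omega> in M. mono_on {0..} (\<lambda>t. X t \<omega>))"

definition finite_variation_upto :: "(real \<Rightarrow> real) \<Rightarrow> real \<Rightarrow> bool" where
  "finite_variation_upto f T \<longleftrightarrow>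
     (\<exists>B. \<forall>(n::nat) (t :: nat \<Rightarrow> real). mono_on {..n} t \<and> t ` {..n} \<subseteq> {0..T} \<longrightarrow>
        (\<Sum>i<n. \<bar>f (t (Suc i)) - f (t i)\<bar>) \<le> B)"

definition bounded_variation_paths :: "'w measure \<Rightarrow> (real \<Rightarrow> 'w \<Rightarrow> real) \<Rightarrow> bool" where
  "bounded_variation_paths M X \<longleftrightarrow>
     (AE \<omega> in M. \<forall>T\<ge>0. finite_variation_upto (\<lambda>t. X t \<omega>) T)"

section \<open>Laplace exponent\<close>

text \<open>A measure on \<open>(0, \<infinity>)\<close> is represented by a Borel measure on the reals that does not charge
  \<open>(-\<infinity>, 0]\<close>.\<close>

definition levy_measure :: "real measure \<Rightarrow> bool" where
  "levy_measure \<nu> \<longleftrightarrow> sets \<nu> = sets borel \<and> emeasure \<nu> {..0} = 0 \<and>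
     (\<integral>\<^sup>+x\<in>{0<..}. ennreal (min 1 (x\<^sup>2)) \<partial>\<nu>) < \<infinity>"

definition levy_integrand :: "real \<Rightarrow> real \<Rightarrow> real" where
  "levy_integrand \<theta> x = exp (- \<theta> * x) - 1 + \<theta> * x * indicator {..<1} x"

text \<open>The exponent is a real number exactly when the integral converges, which is automatic for
  \<open>\<theta> \<ge> 0\<close> but not for \<open>\<theta> < 0\<close>; otherwise the value of \<open>laplace_exponent\<close> carries no meaning.\<close>

definition laplace_exponent_finite :: "real measure \<Rightarrow> real \<Rightarrow> bool" where
  "laplace_exponent_finite \<nu> \<theta> \<longleftrightarrow> set_integrable \<nu> {0<..} (levy_integrand \<theta>)"

definition laplace_exponent :: "real \<Rightarrow> real \<Rightarrow> real measure \<Rightarrow> real \<Rightarrow> real" where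
  "laplace_exponent \<mu> b \<nu> \<theta> =
     \<mu> * \<theta> + b\<^sup>2 / 2 * \<theta>\<^sup>2 + (LINT x:{0<..}|\<nu>. levy_integrand \<theta> x)"

definition has_laplace_exponent ::
    "'w measure \<Rightarrow> (real \<Rightarrow> 'w \<Rightarrow> real) \<Rightarrow> real \<Rightarrow> real \<Rightarrow> real measure \<Rightarrow> bool" where
  "has_laplace_exponent M X \<mu> b \<nu> \<longleftrightarrow>
     (\<forall>\<theta>. laplace_exponent_finite \<nu> \<theta> \<longrightarrow>
        (\<forall>t\<ge>0. has_bochner_integral M (\<lambda>\<omega>. exp (- \<theta> * X t \<omega>))
                  (exp (t * laplace_exponent \<mu> b \<nu> \<theta>))))"

section \<open>Naturally enlarged filtration and stopping times\<close>

text \<open>Time is extended to \<open>[0, \<infinity>]\<close>, so that the stopping times of the library are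
  \<open>[0, \<infinity>]\<close>-valued. The filtration is augmented by all subsets of null sets and then made
  right-continuous; the element \<open>\<top>\<close> of the index set of the intersection only matters for
  \<open>t = \<top>\<close>, where no later time exists.\<close>

definition augmented_history ::
    "'w measure \<Rightarrow> (real \<Rightarrow> 'w \<Rightarrow> real) \<Rightarrow> ennreal \<Rightarrow> 'w measure" where
  "augmented_history M X u =
     sigma (space M)
       ({X s -` B \<inter> space M | s B. 0 \<le> s \<and> ennreal s \<le> u \<and> B \<in> sets borel}
         \<union> null_sets (completion M))"

definition enlarged_filtration ::
    "'w measure \<Rightarrow> (real \<Rightarrow> 'w \<Rightarrow> real) \<Rightarrow> ennreal \<Rightarrow> 'w measure" where
  "enlarged_filtration M X t =
     sigma (space M) (\<Inter>u\<in>{u. t < u \<or> u = \<top>}. sets (augmented_history M X u))"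

definition stopping_times ::
    "'w measure \<Rightarrow> (real \<Rightarrow> 'w \<Rightarrow> real) \<Rightarrow> ('w \<Rightarrow> ennreal) set" where
  "stopping_times M X = {\<tau>. stopping_time (enlarged_filtration M X) \<tau>}"

lemma sets_augmented_history:
  "sets (augmented_history M X u) =
     sigma_sets (space M)
       ({X s -` B \<inter> space M | s B. 0 \<le> s \<and> ennreal s \<le> u \<and> B \<in> sets borel}
         \<union> null_sets (completion M))"
proof -
  have "null_sets (completion M) \<subseteq> Pow (space M)"
    using sets.space_closed[of "completion M"] unfolding null_sets_def space_completion by blast
  then show ?thesis
    unfolding augmented_history_def by (intro sets_measure_of) auto
qed

lemma space_augmented_history [simp]: "space (augmented_history M X u) = space M"
  by (simp add: augmented_history_def space_measure_of_conv)

lemma sets_enlarged_filtration: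
  "sets (enlarged_filtration M X t) =
     (\<Inter>u\<in>{u. t < u \<or> u = \<top>}. sets (augmented_history M X u))"
proof -
  have "sigma_algebra (space M) (\<Inter>u\<in>{u. t < u \<or> u = \<top>}. sets (augmented_history M X u))"
    unfolding sigma_algebra_iff2
  proof (intro conjI allI impI)
    show "(\<Inter>u\<in>{u. t < u \<or> u = \<top>}. sets (augmented_history M X u)) \<subseteq> Pow (space M)"
      using sets.sets_into_space[of _ "augmented_history M X \<top>"] by auto
  next
    fix A :: "nat \<Rightarrow> 'a set"
    assume "range A \<subseteq> (\<Inter>u\<in>{u. t < u \<or> u = \<top>}. sets (augmented_history M X u))"
    then show "(\<Union>i. A i) \<in> (\<Inter>u\<in>{u. t < u \<or> u = \<top>}. sets (augmented_history M X u))"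
      by (intro INT_I sets.countable_UN) auto
  qed (use sets.compl_sets[of _ "augmented_history M X u" for u] in auto)
  then show ?thesis
    unfolding enlarged_filtration_def by (rule sigma_algebra.sets_measure_of_eq)
qed

lemma space_enlarged_filtration [simp]: "space (enlarged_filtration M X t) = space M"
  by (simp add: enlarged_filtration_def space_measure_of_conv)

lemma filtration_enlarged_filtration: "filtration (space M) (enlarged_filtration M X)"
  by unfold_locales (auto simp: sets_enlarged_filtration)

section \<open>The stochastic game\<close>

text \<open>Under the law \<open>P\<^sub>x\<close> the process is realised as \<open>x + X\<close> under \<open>M\<close>; \<open>Y\<close> below stands for that
  process. All pay-offs are nonnegative, so expectations are taken in \<open>[0, \<infinity>]\<close>.\<close>

definition running_payoff ::
    "real \<Rightarrow> real \<Rightarrow> real \<Rightarrow> (real \<Rightarrow> 'w \<Rightarrow> real) \<Rightarrow> ennreal \<Rightarrow> 'w \<Rightarrow> ennreal" where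
  "running_payoff \<alpha> \<beta> q Y t \<omega> =
     (\<integral>\<^sup>+s\<in>{s. 0 \<le> s \<and> ennreal s \<le> t}.
        ennreal (exp (- q * s) * (\<alpha> + \<beta> * exp (Y s \<omega>))) \<partial>lborel)"

definition lower_payoff ::
    "real \<Rightarrow> real \<Rightarrow> real \<Rightarrow> (real \<Rightarrow> 'w \<Rightarrow> real) \<Rightarrow> real \<Rightarrow> 'w \<Rightarrow> ennreal" where
  "lower_payoff \<alpha> \<beta> q Y t \<omega> =
     ennreal (exp (- q * t + Y t \<omega>)) + running_payoff \<alpha> \<beta> q Y (ennreal t) \<omega>"

definition upper_payoff ::
    "real \<Rightarrow> real \<Rightarrow> real \<Rightarrow> real \<Rightarrow> (real \<Rightarrow> 'w \<Rightarrow> real) \<Rightarrow> ennreal \<Rightarrow> 'w \<Rightarrow> ennreal" where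
  "upper_payoff \<alpha> \<beta> q K Y t \<omega> =
     (if t = \<top> then 0
      else ennreal (exp (- q * enn2real t) * max (exp (Y (enn2real t) \<omega>)) K))
     + running_payoff \<alpha> \<beta> q Y t \<omega>"

text \<open>On \<open>\<tau> < \<sigma>\<close> the time \<open>\<tau>\<close> is finite, so \<open>enn2real\<close> loses nothing. The integral is taken with
  respect to the completion because stopping times of the enlarged filtration need only be
  measurable with respect to it.\<close>

definition expected_payoff ::
    "'w measure \<Rightarrow> (real \<Rightarrow> 'w \<Rightarrow> real) \<Rightarrow> real \<Rightarrow> real \<Rightarrow> real \<Rightarrow> real \<Rightarrow> real \<Rightarrow>
     ('w \<Rightarrow> ennreal) \<Rightarrow> ('w \<Rightarrow> ennreal) \<Rightarrow> ennreal" where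
  "expected_payoff M X \<alpha> \<beta> q K x \<tau> \<sigma> =
     (\<integral>\<^sup>+\<omega>. (if \<tau> \<omega> < \<sigma> \<omega>
            then lower_payoff \<alpha> \<beta> q (\<lambda>t \<omega>. x + X t \<omega>) (enn2real (\<tau> \<omega>)) \<omega>
            else upper_payoff \<alpha> \<beta> q K (\<lambda>t \<omega>. x + X t \<omega>) (\<sigma> \<omega>) \<omega>) \<partial>completion M)"

text \<open>In the extended nonnegative reals the infimum of the empty set is \<open>\<infinity>\<close>.\<close>

definition first_passage_above ::
    "(real \<Rightarrow> 'w \<Rightarrow> real) \<Rightarrow> real \<Rightarrow> 'w \<Rightarrow> ennreal" where
  "first_passage_above Y c \<omega> = Inf {ennreal t | t. 0 < t \<and> c < Y t \<omega>}"

definition is_saddle_point ::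
    "'s set \<Rightarrow> ('s \<Rightarrow> 's \<Rightarrow> ennreal) \<Rightarrow> 's \<Rightarrow> 's \<Rightarrow> bool" where
  "is_saddle_point S J \<tau>' \<sigma>' \<longleftrightarrow> \<tau>' \<in> S \<and> \<sigma>' \<in> S \<and>
     (\<forall>\<tau>\<in>S. \<forall>\<sigma>\<in>S. J \<tau> \<sigma>' \<le> J \<tau>' \<sigma>' \<and> J \<tau>' \<sigma>' \<le> J \<tau>' \<sigma>)"

definition has_game_value ::
    "'s set \<Rightarrow> ('s \<Rightarrow> 's \<Rightarrow> ennreal) \<Rightarrow> ennreal \<Rightarrow> bool" where
  "has_game_value S J v \<longleftrightarrow>
     (SUP \<tau>\<in>S. INF \<sigma>\<in>S. J \<tau> \<sigma>) = v \<and> (INF \<sigma>\<in>S. SUP \<tau>\<in>S. J \<tau> \<sigma>) = v"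

end

theory Submission
  imports Defs
begin

text \<open>Against \<open>\<sigma> = 0\<close> every \<open>\<tau>\<close> yields \<open>max K (exp x)\<close>. Conversely, let \<open>T\<close> be the minimum of
  \<open>\<sigma>\<close> and the first passage time above \<open>ln K\<close>. If \<open>exp x \<le> K\<close>, the terminal pay-off at \<open>T\<close> is at
  least \<open>exp (- q T) K\<close> by right-continuity, while \<open>\<alpha> \<ge> q K\<close> bounds the running pay-off from below
  by \<open>(1 - exp (- q T)) K\<close>, so that the total is at least \<open>K\<close> on almost every path. If \<open>exp x > K\<close>,
  the passage time is almost surely \<open>0\<close>.\<close>

section \<open>Lower bounds for the running pay-off\<close>

lemma running_payoff_0: "running_payoff \<alpha> \<beta> q Y 0 \<omega> = 0"
proof -
  have "{s::real. 0 \<le> s \<and> ennreal s \<le> 0} = {0}"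
    by (auto simp: ennreal_eq_0_iff)
  moreover have "(\<integral>\<^sup>+s\<in>{0}. f s \<partial>lborel) = 0" for f :: "real \<Rightarrow> ennreal"
    by (rule nn_integral_null_set) auto
  ultimately show ?thesis
    by (simp add: running_payoff_def)
qed

text \<open>The left-hand side is the derivative in \<open>s\<close> of
  \<open>- c * exp (- q * s)\<close>, so the bound integrates in closed form. It is used with
  \<open>c = K\<close>.\<close>

lemma running_rate_ge:
  fixes c q \<alpha> \<beta> :: real
  assumes "c * q \<le> \<alpha>" "0 \<le> \<beta>"
  shows "c * q * exp (- q * s) \<le> exp (- q * s) * (\<alpha> + \<beta> * exp y)"
  using assms mult_right_mono[of "c * q" "\<alpha> + \<beta> * exp y" "exp (- q * s)"]
  by (simp add: mult.commute add_increasing2)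

lemma running_payoff_ge_discount:
  assumes "0 \<le> c" "c * q \<le> \<alpha>" "0 \<le> \<beta>" "0 < q" "0 \<le> r"
  shows "ennreal (c * (1 - exp (- q * r))) \<le> running_payoff \<alpha> \<beta> q Y (ennreal r) \<omega>"
proof -
  have "ennreal (c * (1 - exp (- q * r))) = (\<integral>\<^sup>+s. ennreal (c * q * exp (- q * s)) * indicator {0..r} s \<partial>lborel)"
    using assms
    by (subst nn_integral_FTC_Icc[where F = "\<lambda>s. - c * exp (- q * s)"])
       (auto intro!: derivative_eq_intros simp: algebra_simps)
  also have "\<dots> \<le> running_payoff \<alpha> \<beta> q Y (ennreal r) \<omega>"
    unfolding running_payoff_def
  proof (intro nn_integral_mono)
    fix s :: real
    show "ennreal (c * q * exp (- q * s)) * indicator {0..r} s \<le>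
        ennreal (exp (- q * s) * (\<alpha> + \<beta> * exp (Y s \<omega>))) * indicator {s. 0 \<le> s \<and> ennreal s \<le> ennreal r} s"
      using assms running_rate_ge[of c q \<alpha> \<beta> s "Y s \<omega>"] by (auto simp: indicator_def ennreal_leI)
  qed
  finally show ?thesis .
qed

text \<open>Serves the paths on which nobody stops: there is no terminal pay-off, and the stream
  alone must reach \<open>c\<close>. The limit of \<open>- c * exp (- q * r)\<close> at infinity is
  0, so the integral of the lower rate is exactly \<open>c\<close>.\<close>

lemma running_payoff_top_ge:
  assumes "0 \<le> c" "c * q \<le> \<alpha>" "0 \<le> \<beta>" "0 < q"
  shows "ennreal c \<le> running_payoff \<alpha> \<beta> q Y \<top> \<omega>"
proof -
  have "((\<lambda>r. - c * exp (- q * r)) \<longlongrightarrow> - c * 0) at_top"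
    using assms
    by (intro tendsto_intros filterlim_compose[OF exp_at_bot]
        filterlim_tendsto_neg_mult_at_bot[OF tendsto_const] filterlim_ident) auto
  then have "ennreal c = (\<integral>\<^sup>+s. ennreal (c * q * exp (- q * s)) * indicator {0..} s \<partial>lborel)"
    using assms
    by (subst nn_integral_FTC_atLeast[where F = "\<lambda>s. - c * exp (- q * s)" and T = 0])
       (auto intro!: derivative_eq_intros simp: algebra_simps)
  also have "\<dots> \<le> running_payoff \<alpha> \<beta> q Y \<top> \<omega>"
    unfolding running_payoff_def
  proof (intro nn_integral_mono)
    fix s :: real
    show "ennreal (c * q * exp (- q * s)) * indicator {0..} s \<le>
        ennreal (exp (- q * s) * (\<alpha> + \<beta> * exp (Y s \<omega>))) * indicator {s. 0 \<le> s \<and> ennreal s \<le> \<top>} s"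
      using assms running_rate_ge[of c q \<alpha> \<beta> s "Y s \<omega>"] by (auto simp: indicator_def ennreal_leI)
  qed
  finally show ?thesis .
qed

text \<open>Split \<open>c\<close> as \<open>exp (- q * r) * c\<close> plus
  \<open>c * (1 - exp (- q * r))\<close>: the terminal value covers the first part, the stream the
  second.\<close>

lemma discount_plus_running_payoff_ge:
  assumes "0 \<le> c" "c * q \<le> \<alpha>" "0 \<le> \<beta>" "0 < q" "0 \<le> r" "c \<le> z"
  shows "ennreal c \<le> ennreal (exp (- q * r) * z) + running_payoff \<alpha> \<beta> q Y (ennreal r) \<omega>"
proof -
  have "ennreal c = ennreal (exp (- q * r) * c) + ennreal (c * (1 - exp (- q * r)))"
    using assms by (subst ennreal_plus[symmetric]) (auto simp: right_diff_distrib mult_left_le)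
  also have "\<dots> \<le> ennreal (exp (- q * r) * z) + running_payoff \<alpha> \<beta> q Y (ennreal r) \<omega>"
    using assms by (intro add_mono running_payoff_ge_discount ennreal_leI mult_left_mono) auto
  finally show ?thesis .
qed

section \<open>First passage along a single cadlag path\<close>

lemma first_passage_above_less_iff:
  "first_passage_above Y c \<omega> < u \<longleftrightarrow> (\<exists>t>0. ennreal t < u \<and> c < Y t \<omega>)"
  by (auto simp: first_passage_above_def Inf_less_iff)

text \<open>If the path were below \<open>c\<close> at the infimum \<open>T\<close>,
  right-continuity would keep it below \<open>c\<close> on a whole interval to the right of
  \<open>T\<close>. The inequality is weak since the infimum need not be attained.\<close>

lemma cadlag_at_first_passage_above:
  assumes "cadlag (\<lambda>t. Y t \<omega>)" "first_passage_above Y c \<omega> < \<top>"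
  shows "c \<le> Y (enn2real (first_passage_above Y c \<omega>)) \<omega>"
proof (rule ccontr)
  define T where "T = enn2real (first_passage_above Y c \<omega>)"
  have T: "first_passage_above Y c \<omega> = ennreal T" "0 \<le> T"
    using assms(2) by (auto simp: T_def)
  assume "\<not> ?thesis"
  then have less: "Y T \<omega> < c"
    by (simp add: T_def)
  have "((\<lambda>t. Y t \<omega>) \<longlongrightarrow> Y T \<omega>) (at_right T)"
    using assms(1) T(2) by (simp add: cadlag_def)
  from order_tendstoD(2)[OF this less]
  obtain b where b: "T < b" "\<And>t. T < t \<Longrightarrow> t < b \<Longrightarrow> Y t \<omega> < c"
    unfolding eventually_at_right_field by blast
  have "first_passage_above Y c \<omega> < ennreal b"
    using b T by (simp add: ennreal_lessI)
  then obtain t where t: "0 < t" "ennreal t < ennreal b" "c < Y t \<omega>"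
    by (auto simp: first_passage_above_less_iff)
  have "first_passage_above Y c \<omega> \<le> ennreal t"
    using t unfolding first_passage_above_def by (intro Inf_lower) auto
  then have "T \<le> t" "t < b"
    using T t by (auto simp: ennreal_less_iff)
  \<comment> \<open>The right neighbourhood omits its endpoint, so \<open>t = T\<close> is refuted
    by \<open>less\<close> instead.\<close>
  then show False
    using b(2)[of t] t(3) less by (cases "t = T") auto
qed

text \<open>The infimum ranges over \<open>t > 0\<close> only, so the value at time 0 does not
  settle the claim; right-continuity supplies arbitrarily small positive times above
  \<open>c\<close>.\<close>

lemma cadlag_first_passage_above_eq_0:
  assumes "cadlag (\<lambda>t. Y t \<omega>)" "c < Y 0 \<omega>"
  shows "first_passage_above Y c \<omega> = 0"
proof (rule ccontr)
  assume "first_passage_above Y c \<omega> \<noteq> 0"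
  then obtain u where u: "0 < u" "u < first_passage_above Y c \<omega>"
    using dense[of 0 "first_passage_above Y c \<omega>"] by (auto simp: zero_less_iff_neq_zero)
  have "((\<lambda>t. Y t \<omega>) \<longlongrightarrow> Y 0 \<omega>) (at_right 0)"
    using assms(1) by (simp add: cadlag_def)
  from order_tendstoD(1)[OF this assms(2)]
  obtain b where b: "0 < b" "\<And>t. 0 < t \<Longrightarrow> t < b \<Longrightarrow> c < Y t \<omega>"
    unfolding eventually_at_right_field by blast
  obtain r where r: "u = ennreal r" "0 < r"
    using u by (cases u) auto
  define t where "t = min r b / 2"
  have "0 < t" "t < b" "t < r"
    using r b by (auto simp: t_def)
  then have "first_passage_above Y c \<omega> < u"
    using b(2)[of t] r by (auto simp: first_passage_above_less_iff ennreal_less_iff intro!: exI[of _ t])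
  with u show False by simp
qed

lemma cadlag_add_const:
  assumes "cadlag f"
  shows "cadlag (\<lambda>t. x + f t)"
  unfolding cadlag_def
proof (intro conjI allI impI)
  fix t :: real assume "0 \<le> t"
  then show "((\<lambda>t. x + f t) \<longlongrightarrow> x + f t) (at_right t)"
    using assms by (intro tendsto_add tendsto_const) (simp add: cadlag_def)
next
  fix t :: real assume "0 < t"
  then obtain l where "(f \<longlongrightarrow> l) (at_left t)"
    using assms by (auto simp: cadlag_def)
  then show "\<exists>l. ((\<lambda>t. x + f t) \<longlongrightarrow> l) (at_left t)"
    by (intro exI[of _ "x + l"] tendsto_intros)
qed

text \<open>Right-continuity allows moving \<open>t\<close> slightly to the right onto a rational.
  This turns the passage event into a countable union.\<close>

lemma cadlag_exceeds_at_rational: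
  assumes "cadlag f" "0 < t" "ennreal t < u" "c < f t"
  shows "\<exists>r\<in>\<rat>. 0 < r \<and> ennreal r < u \<and> c < f r"
proof -
  have "(f \<longlongrightarrow> f t) (at_right t)"
    using assms by (simp add: cadlag_def)
  from order_tendstoD(1)[OF this assms(4)]
  obtain b where b: "t < b" "\<And>s. t < s \<Longrightarrow> s < b \<Longrightarrow> c < f s"
    unfolding eventually_at_right_field by blast
  \<comment> \<open>\<open>u\<close> may be \<open>\<top>\<close>; an intermediate \<open>v\<close>
    is finite and can be compared with \<open>r\<close> as a real.\<close>
  obtain v where v: "ennreal t < v" "v < u"
    using dense[OF assms(3)] by auto
  then obtain d where d: "v = ennreal d" "t < d"
    using assms(2) by (cases v) (auto simp: ennreal_less_iff)
  obtain r where r: "r \<in> \<rat>" "t < r" "r < min b d"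
    using Rats_dense_in_real[of t "min b d"] b d by auto
  then have "ennreal r < v"
    using assms(2) d by (simp add: ennreal_less_iff)
  with r b(2)[of r] v assms(2) show ?thesis
    by (intro bexI[of _ r]) auto
qed

section \<open>The passage time as a stopping time\<close>

lemma sets_augmented_history_mono:
  assumes "u \<le> v"
  shows "sets (augmented_history M X u) \<subseteq> sets (augmented_history M X v)"
  unfolding sets_augmented_history
  using assms by (intro sigma_sets_mono') (auto intro: order_trans)

context levy_process
begin

text \<open>The event contains the countable union \<open>B\<close> over rational times and exceeds
  it only on paths that are not cadlag. That excess lies in a null set, hence in the augmented
  history.\<close>

lemma first_passage_above_less_augmented:
  "{\<omega>\<in>space M. first_passage_above (\<lambda>t \<omega>. x + X t \<omega>) c \<omega> < u} \<in> sets (augmented_history M X u)"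
  (is "?A \<in> _")
proof -
  define B where "B = (\<Union>r\<in>{r\<in>\<rat>. 0 < r \<and> ennreal r < u}. X r -` {c - x<..} \<inter> space M)"
  have "X r -` {c - x<..} \<inter> space M \<in> sets (augmented_history M X u)"
    if "0 < r" "ennreal r < u" for r
    unfolding sets_augmented_history
    using that by (intro sigma_sets.Basic UnI1 CollectI exI[of _ r] exI[of _ "{c - x<..}"]) auto
  then have B: "B \<in> sets (augmented_history M X u)"
    unfolding B_def
    by (intro sets.countable_UN') (auto intro: countable_subset[OF _ countable_rat])
  obtain N where N: "N \<in> null_sets M" "{\<omega>\<in>space M. \<not> cadlag (\<lambda>t. X t \<omega>)} \<subseteq> N"
    using cadlag_paths by (auto simp: eventually_ae_filter)
  have "?A - B \<subseteq> N"
  proof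
    fix \<omega> assume \<omega>: "\<omega> \<in> ?A - B"
    then obtain t where t: "0 < t" "ennreal t < u" "c - x < X t \<omega>"
      by (auto simp: first_passage_above_less_iff algebra_simps)
    then have "\<not> cadlag (\<lambda>t. X t \<omega>)"
      using cadlag_exceeds_at_rational[of "\<lambda>t. X t \<omega>" t u "c - x"] \<omega> by (auto simp: B_def)
    with N \<omega> show "\<omega> \<in> N" by auto
  qed
  with N have "?A - B \<in> null_sets (completion M)"
    by (blast intro: null_sets_completion_subset null_sets_completionI)
  then have "?A - B \<in> sets (augmented_history M X u)"
    unfolding sets_augmented_history by (intro sigma_sets.Basic) auto
  with B have "B \<union> (?A - B) \<in> sets (augmented_history M X u)"
    by (rule sets.Un)
  moreover have "B \<subseteq> ?A"
    by (auto simp: B_def first_passage_above_less_iff algebra_simps)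
  then have "B \<union> (?A - B) = ?A" by blast
  ultimately show ?thesis by simp
qed

text \<open>Right-continuity of the enlarged filtration is the point: for \<open>t < \<top>\<close>,
  passage by time \<open>t\<close> is the intersection of the events of passage strictly before
  times decreasing to \<open>t\<close>.\<close>

lemma first_passage_above_stopping_time:
  "first_passage_above (\<lambda>t \<omega>. x + X t \<omega>) c \<in> stopping_times M X" (is "?\<tau> \<in> _")
  unfolding stopping_times_def mem_Collect_eq stopping_time_def
proof
  fix t :: ennreal
  have "{\<omega>\<in>space M. ?\<tau> \<omega> \<le> t} \<in> sets (augmented_history M X u)" if u: "t < u \<or> u = \<top>" for u
  proof (cases "t = \<top>")
    case True
    then show ?thesis
      using sets.top[of "augmented_history M X u"] by simp
  next
    case False
    \<comment> \<open>The cap by \<open>u\<close> keeps every event inside the history up to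
      \<open>u\<close>.\<close>
    define v where "v n = min u (t + ennreal (1 / Suc n))" for n :: nat
    have t_less: "t < v n" for n
    proof -
      have "0 < ennreal (1 / Suc n)" by simp
      then have "t < t + ennreal (1 / Suc n)"
        using False by (cases t) (auto simp flip: ennreal_plus simp: ennreal_less_iff)
      moreover have "t < u" using u False by (auto simp: top.not_eq_extremum)
      ultimately show ?thesis by (simp add: v_def)
    qed
    have "?\<tau> \<omega> \<le> t \<longleftrightarrow> (\<forall>n. ?\<tau> \<omega> < v n)" for \<omega>
    proof
      assume "?\<tau> \<omega> \<le> t"
      then show "\<forall>n. ?\<tau> \<omega> < v n" using t_less by (auto intro: le_less_trans)
    next
      assume *: "\<forall>n. ?\<tau> \<omega> < v n"
      show "?\<tau> \<omega> \<le> t"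
      proof (rule ennreal_le_epsilon)
        fix e :: real assume "0 < e"
        then obtain n where n: "1 / Suc n < e"
          using nat_approx_posE by blast
        have "?\<tau> \<omega> \<le> t + ennreal (1 / Suc n)"
          using * by (auto simp: v_def intro: less_imp_le)
        also have "\<dots> \<le> t + ennreal e"
          using n by (intro add_left_mono ennreal_leI) auto
        finally show "?\<tau> \<omega> \<le> t + ennreal e" .
      qed
    qed
    then have "{\<omega>\<in>space M. ?\<tau> \<omega> \<le> t} = (\<Inter>n. {\<omega>\<in>space M. ?\<tau> \<omega> < v n})"
      by auto
    moreover have "{\<omega>\<in>space M. ?\<tau> \<omega> < v n} \<in> sets (augmented_history M X u)" for n
      using first_passage_above_less_augmented[of x c "v n"] sets_augmented_history_mono[of "v n" u M X]
      by (auto simp: v_def)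
    then have "(\<Inter>n. {\<omega>\<in>space M. ?\<tau> \<omega> < v n}) \<in> sets (augmented_history M X u)"
      by (intro sets.countable_INT) auto
    ultimately show ?thesis by simp
  qed
  then show "Measurable.pred (enlarged_filtration M X t) (\<lambda>\<omega>. ?\<tau> \<omega> \<le> t)"
    by (simp add: pred_def sets_enlarged_filtration)
qed

section \<open>Expected pay-offs of the two strategies\<close>

lemma AE_completion_regular_paths:
  "AE \<omega> in completion M. X 0 \<omega> = 0 \<and> cadlag (\<lambda>t. x + X t \<omega>)"
  using AE_completion[OF start_zero] AE_completion[OF cadlag_paths]
  by eventually_elim (simp add: cadlag_add_const)

text \<open>No \<open>\<tau>\<close> stops strictly before time 0, so the integrand is the upper
  pay-off at 0, almost surely the constant \<open>max K (exp x)\<close>.\<close>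

lemma expected_payoff_sigma_0:
  "expected_payoff M X \<alpha> \<beta> q K x \<tau> (\<lambda>\<omega>. 0) = ennreal (max K (exp x))"
proof -
  have "expected_payoff M X \<alpha> \<beta> q K x \<tau> (\<lambda>\<omega>. 0) = (\<integral>\<^sup>+\<omega>. ennreal (max K (exp x)) \<partial>completion M)"
    unfolding expected_payoff_def
    using AE_completion_regular_paths[of x]
    by (intro nn_integral_cong_AE, eventually_elim)
       (simp add: upper_payoff_def running_payoff_0 max.commute)
  then show ?thesis
    by (simp add: emeasure_space_1)
qed

text \<open>The bound holds for the integrand on every path that starts at 0 and is cadlag, whatever
  the value of \<open>\<sigma>\<close> there; integrating over a probability space preserves
  it.\<close>

lemma expected_payoff_first_passage_ge:
  assumes "0 < K" "K * q \<le> \<alpha>" "0 \<le> \<beta>" "0 < q"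
  shows "ennreal (max K (exp x)) \<le>
    expected_payoff M X \<alpha> \<beta> q K x (first_passage_above (\<lambda>t \<omega>. x + X t \<omega>) (ln K)) \<sigma>"
proof -
  let ?Y = "\<lambda>t \<omega>. x + X t \<omega>"
  let ?\<tau> = "first_passage_above ?Y (ln K)"
  let ?J = "\<lambda>\<omega>. if ?\<tau> \<omega> < \<sigma> \<omega> then lower_payoff \<alpha> \<beta> q ?Y (enn2real (?\<tau> \<omega>)) \<omega>
    else upper_payoff \<alpha> \<beta> q K ?Y (\<sigma> \<omega>) \<omega>"
  have "ennreal (max K (exp x)) \<le> ?J \<omega>" if X0: "X 0 \<omega> = 0" and cad: "cadlag (\<lambda>t. ?Y t \<omega>)" for \<omega>
  proof (cases "K < exp x")
    case True
    then have "ln K < x"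
      using assms(1) by (metis exp_less_cancel_iff exp_ln)
    then have "?\<tau> \<omega> = 0"
      using cadlag_first_passage_above_eq_0[of ?Y \<omega> "ln K"] cad X0 by simp
    \<comment> \<open>Whether \<open>\<sigma>\<close> is zero or positive, the game ends at time 0
      and pays \<open>exp x\<close>.\<close>
    then show ?thesis
      using True X0
      by (cases "\<sigma> \<omega> = 0")
         (auto simp: lower_payoff_def upper_payoff_def running_payoff_0 max_def zero_less_iff_neq_zero)
  next
    case False
    have "ennreal K \<le> ?J \<omega>"
    proof (cases "?\<tau> \<omega> < \<sigma> \<omega>")
      case True
      then have fin: "?\<tau> \<omega> < \<top>"
        by (auto simp: less_top intro: less_le_trans)
      have "ln K \<le> ?Y (enn2real (?\<tau> \<omega>)) \<omega>"
        using cadlag_at_first_passage_above[of ?Y \<omega> "ln K"] cad fin by simp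
      then have "K \<le> exp (?Y (enn2real (?\<tau> \<omega>)) \<omega>)"
        using assms(1) by (metis exp_le_cancel_iff exp_ln)
      then have "ennreal K \<le> lower_payoff \<alpha> \<beta> q ?Y (enn2real (?\<tau> \<omega>)) \<omega>"
        \<comment> \<open>Separates the discount factor from the terminal value, as the bound for
          stopping at a finite time expects.\<close>
        unfolding lower_payoff_def exp_add[of "- q * enn2real (?\<tau> \<omega>)"]
        using assms by (intro discount_plus_running_payoff_ge) auto
      with True show ?thesis by simp
    next
      case not_less: False
      show ?thesis
      \<comment> \<open>If \<open>\<sigma>\<close> is infinite here, so is the passage time, and
        only the running pay-off remains.\<close>
      proof (cases "\<sigma> \<omega> = \<top>")
        case True
        then show ?thesis
          using not_less running_payoff_top_ge[of K q \<alpha> \<beta>] assms by (simp add: upper_payoff_def)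
      next
        case False
        then have "ennreal (enn2real (\<sigma> \<omega>)) = \<sigma> \<omega>"
          by (simp add: less_top)
        then show ?thesis
          using not_less False assms
            discount_plus_running_payoff_ge[of K q \<alpha> \<beta> "enn2real (\<sigma> \<omega>)"
              "max (exp (?Y (enn2real (\<sigma> \<omega>)) \<omega>)) K" ?Y \<omega>]
          by (simp add: upper_payoff_def)
      qed
    qed
    with False show ?thesis by (simp add: max_def)
  qed
  then have "(\<integral>\<^sup>+\<omega>. ennreal (max K (exp x)) \<partial>completion M) \<le> (\<integral>\<^sup>+\<omega>. ?J \<omega> \<partial>completion M)"
    by (intro nn_integral_mono_AE eventually_mono[OF AE_completion_regular_paths[of x]]) blast
  then show ?thesis
    by (simp add: expected_payoff_def emeasure_space_1)
qed

end

section \<open>From the saddle point to the value\<close>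

lemma zero_in_stopping_times: "(\<lambda>\<omega>. 0) \<in> stopping_times M X"
  by (simp add: stopping_times_def stopping_time_def)

text \<open>Testing with \<open>\<sigma>'\<close> bounds both iterated extrema from above, testing
  with \<open>\<tau>'\<close> bounds both from below.\<close>

lemma saddle_point_has_game_value:
  assumes "is_saddle_point S J \<tau>' \<sigma>'"
  shows "has_game_value S J (J \<tau>' \<sigma>')"
  unfolding has_game_value_def
proof (intro conjI antisym)
  note S = assms[unfolded is_saddle_point_def]
  show "(SUP \<tau>\<in>S. INF \<sigma>\<in>S. J \<tau> \<sigma>) \<le> J \<tau>' \<sigma>'"
    using S by (intro SUP_least INF_lower2[of \<sigma>']) auto
  show "J \<tau>' \<sigma>' \<le> (SUP \<tau>\<in>S. INF \<sigma>\<in>S. J \<tau> \<sigma>)"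
    using S by (intro SUP_upper2[of \<tau>'] INF_greatest) auto
  show "(INF \<sigma>\<in>S. SUP \<tau>\<in>S. J \<tau> \<sigma>) \<le> J \<tau>' \<sigma>'"
    using S by (intro INF_lower2[of \<sigma>'] SUP_least) auto
  show "J \<tau>' \<sigma>' \<le> (INF \<sigma>\<in>S. SUP \<tau>\<in>S. J \<tau> \<sigma>)"
    using S by (intro INF_greatest SUP_upper2[of \<tau>']) auto
qed

theorem theorem1:
  fixes M :: "'w measure"
    and X :: "real \<Rightarrow> 'w \<Rightarrow> real"
    and \<mu> b \<alpha> \<beta> q K :: real
    and \<nu> :: "real measure"
  assumes "spectrally_positive_levy_process M X"
    and "levy_measure \<nu>"
    and "has_laplace_exponent M X \<mu> b \<nu>"
    and "bounded_variation_paths M X \<Longrightarrow> (\<forall>x>0. emeasure \<nu> {x} = 0)"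
    and "0 \<le> \<alpha>" and "0 < \<beta>" and "0 < q" and "0 < K"
    and "laplace_exponent_finite \<nu> (-1)" and "laplace_exponent \<mu> b \<nu> (-1) < q"
    and "q \<le> \<alpha> / K"
  shows "\<forall>x::real.
           is_saddle_point (stopping_times M X) (expected_payoff M X \<alpha> \<beta> q K x)
             (first_passage_above (\<lambda>t \<omega>. x + X t \<omega>) (ln K)) (\<lambda>\<omega>. 0) \<and>
           has_game_value (stopping_times M X) (expected_payoff M X \<alpha> \<beta> q K x)
             (ennreal (max K (exp x)))"
proof
  fix x :: real
  interpret spectrally_positive_levy_process M X by fact
  let ?J = "expected_payoff M X \<alpha> \<beta> q K x"
  let ?\<tau> = "first_passage_above (\<lambda>t \<omega>. x + X t \<omega>) (ln K)"
  have "K * q \<le> \<alpha>"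
    using assms(8,11) by (simp add: field_simps)
  \<comment> \<open>The first saddle inequality is an equality, as the pay-off against \<sigma> = 0
    is the same for all \<open>\<tau>\<close>; the second is the pathwise bound with
    \<open>c = K\<close>.\<close>
  then have "is_saddle_point (stopping_times M X) ?J ?\<tau> (\<lambda>\<omega>. 0)"
    using assms(6-8) expected_payoff_first_passage_ge[of K q \<alpha> \<beta> x]
    by (auto simp: is_saddle_point_def expected_payoff_sigma_0 zero_in_stopping_times
        first_passage_above_stopping_time)
  with saddle_point_has_game_value[OF this]
  show "is_saddle_point (stopping_times M X) ?J ?\<tau> (\<lambda>\<omega>. 0) \<and>
      has_game_value (stopping_times M X) ?J (ennreal (max K (exp x)))"
    by (simp add: expected_payoff_sigma_0)
qed

end
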